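(* Let $I$ be an arbitrary index set. Then the Banach space $\ell_1(I)$, with the metric induced by its norm, is a tripod space. In particular, when $I$ is a finite set with $n$ elements, the space $\ell_1(I)=(\mathbb{R}^n,d_1)$ is a tripod space.
   Context: For an index set $I$, $\ell_1(I)$ is the set of all families $(x_i)_{i\in I}$ of real numbers with $\sum_{i\in I}|x_i|<\infty$, endowed with the metric $d_1((x_i),(y_i))=\sum_{i\in I}|x_i-y_i|$. The length of a continuous path $c:[0,1]\to X$ in a metric space $(X,d)$ is the supremum of $\sum_i d(c(t_i),c(t_{i-1}))$ over all partitions of $[0,1]$. A metric space $(X,d)$ is geodesic if any two points $x,y\in X$ are joined by a path of length $d(x,y)$ (a shortest geodesic). A geodesic space $(X,d)$ is a tripod space if for any three points $x_1,x_2,x_3\in X$ there exists a point $m\in X$ (a median, not required to be unique) with $d(x_i,m)+d(x_j,m)=d(x_i,x_j)$ for all $1\le i<j\le 3$. *)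

theory Defs
  imports "HOL-Analysis.Analysis"
begin

text \<open>A partition \<open>0 = t 0 < t 1 < \<dots> < t n = 1\<close> is encoded by \<open>(n, t)\<close>;
  the values \<open>t k\<close> with \<open>k > n\<close> play no role.\<close>

definition partitions01 :: "(nat \<times> (nat \<Rightarrow> real)) set" where
  "partitions01 = {(n, t). t 0 = 0 \<and> t n = 1 \<and> (\<forall>k<n. t k < t (Suc k))}"

definition path_length :: "('a \<Rightarrow> 'a \<Rightarrow> real) \<Rightarrow> (real \<Rightarrow> 'a) \<Rightarrow> ereal" where
  "path_length d c =
     (SUP (n, t) \<in> partitions01. ereal (\<Sum>k<n. d (c (t (Suc k))) (c (t k))))"

definition geodesic_space :: "'a set \<Rightarrow> ('a \<Rightarrow> 'a \<Rightarrow> real) \<Rightarrow> bool" where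
  "geodesic_space X d \<longleftrightarrow> Metric_space X d \<and>
     (\<forall>x\<in>X. \<forall>y\<in>X. \<exists>c. pathin (Metric_space.mtopology X d) c \<and>
        c 0 = x \<and> c 1 = y \<and> path_length d c = ereal (d x y))"

definition tripod_space :: "'a set \<Rightarrow> ('a \<Rightarrow> 'a \<Rightarrow> real) \<Rightarrow> bool" where
  "tripod_space X d \<longleftrightarrow> geodesic_space X d \<and>
     (\<forall>x1\<in>X. \<forall>x2\<in>X. \<forall>x3\<in>X. \<exists>m\<in>X.
        d x1 m + d x2 m = d x1 x2 \<and>
        d x1 m + d x3 m = d x1 x3 \<and>
        d x2 m + d x3 m = d x2 x3)"

text \<open>Families indexed by \<open>I\<close> are extensional functions, so that two elements are equal
  iff they agree on \<open>I\<close>. The index set may be empty or uncountable.\<close>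

definition ell1 :: "'i set \<Rightarrow> ('i \<Rightarrow> real) set" where
  "ell1 I = {x \<in> I \<rightarrow>\<^sub>E UNIV. (\<lambda>i. \<bar>x i\<bar>) summable_on I}"

definition ell1_norm :: "'i set \<Rightarrow> ('i \<Rightarrow> real) \<Rightarrow> real" where
  "ell1_norm I x = (\<Sum>\<^sub>\<infinity>i\<in>I. \<bar>x i\<bar>)"

definition ell1_dist :: "'i set \<Rightarrow> ('i \<Rightarrow> real) \<Rightarrow> ('i \<Rightarrow> real) \<Rightarrow> real" where
  "ell1_dist I x y = ell1_norm I (\<lambda>i\<in>I. x i - y i)"

text \<open>The space \<open>(\<real>\<^sup>n, d\<^sub>1)\<close>, with coordinates numbered \<open>0, \<dots>, n - 1\<close>.\<close>

definition Rn :: "nat \<Rightarrow> (nat \<Rightarrow> real) set" where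
  "Rn n = {..<n} \<rightarrow>\<^sub>E UNIV"

definition Rn_d1 :: "nat \<Rightarrow> (nat \<Rightarrow> real) \<Rightarrow> (nat \<Rightarrow> real) \<Rightarrow> real" where
  "Rn_d1 n x y = (\<Sum>k<n. \<bar>x k - y k\<bar>)"

text \<open>The coordinate map \<open>\<real>\<^sup>I \<rightarrow> \<real>\<^sup>n\<close> determined by an enumeration
  \<open>e 0, \<dots>, e (n - 1)\<close> of \<open>I\<close>.\<close>

definition coords :: "nat \<Rightarrow> (nat \<Rightarrow> 'i) \<Rightarrow> ('i \<Rightarrow> real) \<Rightarrow> (nat \<Rightarrow> real)" where
  "coords n e x = (\<lambda>k\<in>{..<n}. x (e k))"

end

theory Submission imports Defs begin

text \<open>
  Distances in \<open>\<ell>\<^sub>1(I)\<close> are sums of distances between coordinates on the real line, so a linear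
  equation between distances that holds in every coordinate also holds for the families.
  Two facts about the line are needed. The middle one of three reals lies between any two
  of them, so taking it in each coordinate gives a median
  (\<open>tripod_space_ell1\<close>). The segment from \<open>a\<close> to \<open>b\<close> is run through at constant speed
  \<open>\<bar>a - b\<bar>\<close>, so the straight line between two families has constant speed equal to their
  distance, and such a curve has length exactly that distance because the lengths of its pieces
  telescope (\<open>path_length_constant_speed\<close>, \<open>geodesic_space_ell1\<close>). What remains is that the
  families produced in this way are again absolutely summable: they are dominated in
  absolute value by fixed linear combinations of absolutely summable families.

  The finite-dimensional case is the instance where the index set is an initial segment of
  the naturals: there \<open>(\<real>\<^sup>n, d\<^sub>1)\<close> coincides with \<open>\<ell>\<^sub>1\<close> as a set with distance. Numbering
  the coordinates of an arbitrary finite index set only reindexes finite sums.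
\<close>

section \<open>The metric of \<open>\<ell>\<^sub>1(I)\<close>\<close>

lemma ell1I:
  assumes "x \<in> extensional I" and "g summable_on I" and "\<And>i. i \<in> I \<Longrightarrow> \<bar>x i\<bar> \<le> g i"
  shows "x \<in> ell1 I"
proof -
  have "(\<lambda>i. \<bar>x i\<bar>) summable_on I"
    using summable_on_comparison_test[OF assms(2), of "\<lambda>i. \<bar>x i\<bar>"] assms(3) by auto
  then show ?thesis using assms(1) by (simp add: ell1_def PiE_def)
qed

lemma ell1_abs_summable: "x \<in> ell1 I \<Longrightarrow> (\<lambda>i. \<bar>x i\<bar>) summable_on I"
  by (simp add: ell1_def)

lemma ell1_extensional: "x \<in> ell1 I \<Longrightarrow> x \<in> extensional I"
  by (simp add: ell1_def PiE_def)

lemma ell1_dist_eq_infsum: "ell1_dist I x y = (\<Sum>\<^sub>\<infinity>i\<in>I. \<bar>x i - y i\<bar>)"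
  unfolding ell1_dist_def ell1_norm_def by (rule infsum_cong) simp

lemma ell1_diff_summable:
  assumes "x \<in> ell1 I" and "y \<in> ell1 I"
  shows "(\<lambda>i. \<bar>x i - y i\<bar>) summable_on I"
  by (rule summable_on_comparison_test[OF summable_on_add[OF assms[THEN ell1_abs_summable]]])
     (auto simp: abs_triangle_ineq4)

lemma ell1_dist_add:
  assumes "x \<in> ell1 I" and "y \<in> ell1 I" and "z \<in> ell1 I"
  shows "ell1_dist I x z + ell1_dist I y z = (\<Sum>\<^sub>\<infinity>i\<in>I. \<bar>x i - z i\<bar> + \<bar>y i - z i\<bar>)"
  unfolding ell1_dist_eq_infsum
  by (rule infsum_add[symmetric]) (use assms in \<open>auto intro: ell1_diff_summable\<close>)

lemma ell1_dist_commute: "ell1_dist I x y = ell1_dist I y x"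
  by (simp add: ell1_dist_eq_infsum abs_minus_commute)

lemma Metric_space_ell1: "Metric_space (ell1 I) (ell1_dist I)"
proof
  fix x y show "0 \<le> ell1_dist I x y"
    unfolding ell1_dist_eq_infsum by (rule infsum_nonneg) simp
next
  fix x y show "ell1_dist I x y = ell1_dist I y x" by (rule ell1_dist_commute)
next
  fix x y assume xy: "x \<in> ell1 I" "y \<in> ell1 I"
  show "ell1_dist I x y = 0 \<longleftrightarrow> x = y"
  proof
    assume zero: "ell1_dist I x y = 0"
    show "x = y"
    proof (rule extensionalityI[OF xy[THEN ell1_extensional]])
      fix i assume "i \<in> I"
      have "\<bar>x i - y i\<bar> = 0"
        by (rule nonneg_infsum_le_0D[OF _ ell1_diff_summable[OF xy] _ \<open>i \<in> I\<close>])
           (use zero in \<open>simp_all add: ell1_dist_eq_infsum\<close>)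
      then show "x i = y i" by simp
    qed
  qed (simp add: ell1_dist_eq_infsum)
next
  fix x y z assume xyz: "x \<in> ell1 I" "y \<in> ell1 I" "z \<in> ell1 I"
  have "ell1_dist I x z \<le> (\<Sum>\<^sub>\<infinity>i\<in>I. \<bar>x i - y i\<bar> + \<bar>z i - y i\<bar>)"
    unfolding ell1_dist_eq_infsum
    by (rule infsum_mono) (use xyz in \<open>auto intro: ell1_diff_summable summable_on_add\<close>)
  also have "\<dots> = ell1_dist I x y + ell1_dist I y z"
    using ell1_dist_add[of x I z y] xyz ell1_dist_commute[of I y z] by simp
  finally show "ell1_dist I x z \<le> ell1_dist I x y + ell1_dist I y z" .
qed

section \<open>Geodesics\<close>

lemma (in Metric_space) pathin_Lipschitz:
  assumes c: "\<And>s. c s \<in> M" and L: "\<And>s t. d (c s) (c t) \<le> \<bar>s - t\<bar> * L"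
  shows "pathin mtopology c"
  unfolding pathin_def continuous_map_to_metric
proof (intro ballI allI impI)
  fix s \<epsilon> :: real
  assume s: "s \<in> topspace (top_of_set {0..1})" and "0 < \<epsilon>"
  \<comment> \<open>\<open>L\<close> may vanish, for instance along a constant path, so it is enlarged before dividing.\<close>
  define \<delta> where "\<delta> = \<epsilon> / (\<bar>L\<bar> + 1)"
  have "0 < \<delta>" using \<open>0 < \<epsilon>\<close> by (simp add: \<delta>_def)
  have "c u \<in> mball (c s) \<epsilon>" if "dist s u < \<delta>" for u
  proof -
    have "d (c s) (c u) \<le> \<bar>s - u\<bar> * L" by (rule L)
    also have "\<dots> \<le> \<bar>s - u\<bar> * (\<bar>L\<bar> + 1)" by (rule mult_left_mono) auto
    also have "\<dots> < \<delta> * (\<bar>L\<bar> + 1)"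
      using that by (intro mult_strict_right_mono) (auto simp: dist_real_def)
    also have "\<dots> = \<epsilon>" by (simp add: \<delta>_def)
    finally show ?thesis using c by simp
  qed
  then show "\<exists>U. openin (top_of_set {0..1}) U \<and> s \<in> U \<and> (\<forall>u\<in>U. c u \<in> mball (c s) \<epsilon>)"
    using s \<open>0 < \<delta>\<close> by (intro exI[of _ "{0..1} \<inter> ball s \<delta>"]) (auto intro: openin_open_Int)
qed

text \<open>The parameter lengths of the pieces telescope to \<open>1\<close>, so every partition gives the same
  sum, and the supremum is that of a constant.\<close>

lemma path_length_constant_speed:
  assumes speed: "\<And>s t. d (c s) (c t) = \<bar>s - t\<bar> * L"
  shows "path_length d c = ereal L"
proof -
  have "(\<Sum>k<n. d (c (t (Suc k))) (c (t k))) = L" if "(n, t) \<in> partitions01" for n t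
  proof -
    have t: "t 0 = 0" "t n = 1" "\<And>k. k < n \<Longrightarrow> t k < t (Suc k)"
      using that by (auto simp: partitions01_def)
    have "(\<Sum>k<n. d (c (t (Suc k))) (c (t k))) = (\<Sum>k<n. (t (Suc k) - t k) * L)"
      by (rule sum.cong) (use t(3) in \<open>auto simp: speed abs_of_pos\<close>)
    also have "\<dots> = (\<Sum>k<n. t (Suc k) - t k) * L"
      by (simp add: sum_distrib_right)
    also have "\<dots> = L"
      by (simp add: sum_lessThan_telescope t)
    finally show ?thesis .
  qed
  then have "path_length d c = (SUP p \<in> partitions01. ereal L)"
    unfolding path_length_def by (intro SUP_cong) auto
  moreover have "(1, real) \<in> partitions01"
    by (simp add: partitions01_def)
  ultimately show ?thesis by (auto intro: SUP_const)
qed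

lemma geodesic_space_ell1: "geodesic_space (ell1 I) (ell1_dist I)"
  unfolding geodesic_space_def
proof (intro conjI ballI)
  show "Metric_space (ell1 I) (ell1_dist I)" by (rule Metric_space_ell1)
  fix x y assume xy: "x \<in> ell1 I" "y \<in> ell1 I"
  define c where "c s = (\<lambda>i\<in>I. x i + s * (y i - x i))" for s :: real
  have c_in: "c s \<in> ell1 I" for s
  proof (rule ell1I)
    show "(\<lambda>i. \<bar>x i\<bar> + \<bar>s\<bar> * \<bar>y i - x i\<bar>) summable_on I"
      using xy by (intro summable_on_add summable_on_cmult_right ell1_abs_summable ell1_diff_summable)
    fix i assume "i \<in> I"
    then show "\<bar>c s i\<bar> \<le> \<bar>x i\<bar> + \<bar>s\<bar> * \<bar>y i - x i\<bar>"
      using abs_triangle_ineq[of "x i" "s * (y i - x i)"] by (simp add: c_def abs_mult)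
  qed (simp add: c_def)
  have speed: "ell1_dist I (c s) (c t) = \<bar>s - t\<bar> * ell1_dist I x y" for s t
  proof -
    have "\<bar>c s i - c t i\<bar> = \<bar>s - t\<bar> * \<bar>x i - y i\<bar>" if "i \<in> I" for i
    proof -
      have "c s i - c t i = (s - t) * (y i - x i)" using that by (simp add: c_def algebra_simps)
      then show ?thesis by (simp add: abs_mult abs_minus_commute)
    qed
    then have "ell1_dist I (c s) (c t) = (\<Sum>\<^sub>\<infinity>i\<in>I. \<bar>s - t\<bar> * \<bar>x i - y i\<bar>)"
      unfolding ell1_dist_eq_infsum by (rule infsum_cong)
    also have "\<dots> = \<bar>s - t\<bar> * ell1_dist I x y"
      unfolding ell1_dist_eq_infsum
      by (rule infsum_cmult_right) (rule ell1_diff_summable[OF xy])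
    finally show ?thesis .
  qed
  \<comment> \<open>Equality off \<open>I\<close> comes from extensionality of \<open>x\<close> and \<open>y\<close>.\<close>
  have "c 0 = x" "c 1 = y"
    using xy[THEN ell1_extensional] by (auto simp: c_def extensional_def fun_eq_iff)
  moreover have "pathin (Metric_space.mtopology (ell1 I) (ell1_dist I)) c"
    by (rule Metric_space.pathin_Lipschitz[OF Metric_space_ell1, where L = "ell1_dist I x y"])
       (simp_all add: c_in speed)
  moreover have "path_length (ell1_dist I) c = ereal (ell1_dist I x y)"
    by (rule path_length_constant_speed) (rule speed)
  ultimately show "\<exists>c. pathin (Metric_space.mtopology (ell1 I) (ell1_dist I)) c \<and>
      c 0 = x \<and> c 1 = y \<and> path_length (ell1_dist I) c = ereal (ell1_dist I x y)"
    by blast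
qed

section \<open>Medians\<close>

lemma ell1_dist_between:
  assumes "x \<in> ell1 I" and "y \<in> ell1 I" and "m \<in> ell1 I"
    and "\<And>i. i \<in> I \<Longrightarrow> \<bar>x i - m i\<bar> + \<bar>y i - m i\<bar> = \<bar>x i - y i\<bar>"
  shows "ell1_dist I x m + ell1_dist I y m = ell1_dist I x y"
  unfolding ell1_dist_add[OF assms(1-3)]
  unfolding ell1_dist_eq_infsum by (rule infsum_cong) (rule assms(4))

text \<open>The formula clamps \<open>c\<close> to the interval with endpoints \<open>a\<close> and \<open>b\<close>.\<close>

definition median :: "real \<Rightarrow> real \<Rightarrow> real \<Rightarrow> real" where
  "median a b c = max (min a b) (min (max a b) c)"

lemma median_between:
  "\<bar>a - median a b c\<bar> + \<bar>b - median a b c\<bar> = \<bar>a - b\<bar>"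
  "\<bar>a - median a b c\<bar> + \<bar>c - median a b c\<bar> = \<bar>a - c\<bar>"
  "\<bar>b - median a b c\<bar> + \<bar>c - median a b c\<bar> = \<bar>b - c\<bar>"
  by (auto simp: median_def min_def max_def)

text \<open>This domination makes a coordinatewise median of absolutely summable families
  absolutely summable.\<close>

lemma abs_median_le: "\<bar>median a b c\<bar> \<le> \<bar>a\<bar> + \<bar>b\<bar>"
  by (auto simp: median_def min_def max_def)

theorem tripod_space_ell1: "tripod_space (ell1 I) (ell1_dist I)"
  unfolding tripod_space_def
proof (intro conjI ballI)
  show "geodesic_space (ell1 I) (ell1_dist I)" by (rule geodesic_space_ell1)
  fix x y z assume xyz: "x \<in> ell1 I" "y \<in> ell1 I" "z \<in> ell1 I"
  define m where "m = (\<lambda>i\<in>I. median (x i) (y i) (z i))"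
  have m: "m \<in> ell1 I"
  proof (rule ell1I)
    show "(\<lambda>i. \<bar>x i\<bar> + \<bar>y i\<bar>) summable_on I"
      using xyz by (intro summable_on_add ell1_abs_summable)
  qed (simp_all add: m_def abs_median_le)
  have "ell1_dist I x m + ell1_dist I y m = ell1_dist I x y"
    "ell1_dist I x m + ell1_dist I z m = ell1_dist I x z"
    "ell1_dist I y m + ell1_dist I z m = ell1_dist I y z"
    using xyz m by (auto intro!: ell1_dist_between simp: m_def median_between)
  with m show "\<exists>m\<in>ell1 I.
      ell1_dist I x m + ell1_dist I y m = ell1_dist I x y \<and>
      ell1_dist I x m + ell1_dist I z m = ell1_dist I x z \<and>
      ell1_dist I y m + ell1_dist I z m = ell1_dist I y z"
    by blast
qed

section \<open>Finite index sets\<close>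

lemma ell1_finite: "finite I \<Longrightarrow> ell1 I = I \<rightarrow>\<^sub>E UNIV"
  by (auto simp: ell1_def)

lemma ell1_dist_finite: "finite I \<Longrightarrow> ell1_dist I x y = (\<Sum>i\<in>I. \<bar>x i - y i\<bar>)"
  by (simp add: ell1_dist_eq_infsum)

lemma tripod_space_Rn: "tripod_space (Rn n) (Rn_d1 n)"
proof -
  have "Rn n = ell1 {..<n}" "Rn_d1 n = ell1_dist {..<n}"
    by (simp_all add: Rn_def Rn_d1_def ell1_finite ell1_dist_finite fun_eq_iff)
  then show ?thesis by (simp add: tripod_space_ell1)
qed

lemma coords_bij_betw:
  assumes "finite I" and e: "bij_betw e {..<n} I"
  shows "bij_betw (coords n e) (ell1 I) (Rn n)"
proof (rule bij_betw_byWitness[where f' = "\<lambda>y. \<lambda>i\<in>I. y (inv_into {..<n} e i)"])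
  have inv: "inv_into {..<n} e (e k) = k" if "k < n" for k
    using that e by (simp add: bij_betw_inv_into_left)
  have inv': "inv_into {..<n} e i < n" "e (inv_into {..<n} e i) = i" if "i \<in> I" for i
    using that bij_betw_apply[OF bij_betw_inv_into[OF e]] bij_betw_inv_into_right[OF e] by auto
  show "\<forall>x\<in>ell1 I. (\<lambda>i\<in>I. coords n e x (inv_into {..<n} e i)) = x"
    using inv' by (auto simp: coords_def fun_eq_iff dest: ell1_extensional[THEN extensional_arb])
  show "\<forall>y\<in>Rn n. coords n e (\<lambda>i\<in>I. y (inv_into {..<n} e i)) = y"
    using inv bij_betw_apply[OF e]
    by (auto simp: coords_def Rn_def fun_eq_iff PiE_def dest: extensional_arb)
  show "coords n e ` ell1 I \<subseteq> Rn n"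
    by (auto simp: coords_def Rn_def split: if_splits)
  show "(\<lambda>y. \<lambda>i\<in>I. y (inv_into {..<n} e i)) ` Rn n \<subseteq> ell1 I"
    by (auto simp: ell1_finite[OF \<open>finite I\<close>])
qed

lemma Rn_d1_coords:
  assumes "finite I" and e: "bij_betw e {..<n} I"
  shows "Rn_d1 n (coords n e x) (coords n e y) = ell1_dist I x y"
  using sum.reindex_bij_betw[OF e, of "\<lambda>i. \<bar>x i - y i\<bar>"]
  by (simp add: Rn_d1_def coords_def ell1_dist_finite[OF \<open>finite I\<close>])

theorem corollary4p1:
  fixes I :: "'i set"
  shows "tripod_space (ell1 I) (ell1_dist I) \<and>
    (\<forall>n. finite I \<and> card I = n \<longrightarrow>
       (\<forall>e. bij_betw e {..<n} I \<longrightarrow>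
          bij_betw (coords n e) (ell1 I) (Rn n) \<and>
          (\<forall>x\<in>ell1 I. \<forall>y\<in>ell1 I.
             Rn_d1 n (coords n e x) (coords n e y) = ell1_dist I x y)) \<and>
       tripod_space (Rn n) (Rn_d1 n))"
  by (simp add: tripod_space_ell1 tripod_space_Rn coords_bij_betw Rn_d1_coords)

end
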